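(* Let $1\le k\le n$ and $\mu>0$. The average execution time of the coded distributed computing system with $n$ servers and straggling parameter $\mu$, using random linear codes from the ensemble $\mathcal{R}(n,k)$ under maximum a posteriori (MAP) decoding, is $$T_{\rm avg}=\frac{1}{k}\left[1+\sum_{i=n-k+1}^{n}\frac{1}{i\mu}\right]+\frac{1}{\mu k}\sum_{i=1}^{n-k}\frac{1}{i}\,p_f(i,k),\qquad p_f(i,k)=1-\frac{\prod_{j=1}^{k}\left(1-2^{\,j-1-n+i}\right)}{\prod_{l=1}^{k}\left(1-2^{\,l-1-n}\right)}.$$
   Context: System model. A computational job is divided equally into $k$ tasks, encoded by an $(n,k)$ linear code into $n$ encoded tasks, and the $j$-th encoded task is assigned to the $j$-th of $n$ servers. The run times $T_1,\dots,T_n$ of the servers are i.i.d. (and independent of the choice of code) with shifted-exponential distribution $\Pr(T_i\le t)=1-\exp(-\mu(kt-1))$ for $t\ge 1/k$, and $\Pr(T_i\le t)=0$ for $t<1/k$. An encoded task not completed by time $t$ is regarded as erased. $\mathcal{R}(n,k)$ denotes the random ensemble of binary linear codes obtained by picking the entries of the $k\times n$ generator matrix over $\mathbb{F}_2$ independently and uniformly at random and removing those matrices that do not have full row rank; i.e. the generator matrix $\mathbf{G}$ is uniformly distributed over all $k\times n$ matrices over $\mathbb{F}_2$ of rank $k$. Under MAP decoding, a set $S\subseteq\{1,\dots,n\}$ of unerased symbols is decodable if and only if the $k\times|S|$ submatrix of $\mathbf{G}$ formed by the columns indexed by $S$ has full row rank $k$ (over $\mathbb{F}_2$). The total job completion time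 $T$ is the first time $t$ at which $\{i:T_i\le t\}$ is decodable, and $T_{\rm avg}=\mathbb{E}[T]$, the expectation being over the run times and the random code. *)

theory Defs
  imports
    "HOL-Probability.Probability"
    "HOL-Library.Z2"
    "Jordan_Normal_Form.DL_Rank"
    "Jordan_Normal_Form.DL_Submatrix"
begin

text \<open>
  Servers, and accordingly the columns of a generator matrix, are indexed by
  \<open>0, \<dots>, n - 1\<close>. The type \<^typ>\<open>bit\<close> is the field with two elements.
\<close>

definition full_row_rank :: "bit mat \<Rightarrow> bool"
  where "full_row_rank A \<longleftrightarrow> vec_space.rank (dim_row A) A = dim_row A"

definition generator_matrices :: "nat \<Rightarrow> nat \<Rightarrow> bit mat set"
  where "generator_matrices n k = {A \<in> carrier_mat k n. full_row_rank A}"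

text \<open>The law of the generator matrix of a code drawn from the ensemble \<open>\<R>(n,k)\<close>.\<close>

definition random_code_ensemble :: "nat \<Rightarrow> nat \<Rightarrow> bit mat measure"
  where "random_code_ensemble n k = uniform_count_measure (generator_matrices n k)"

definition decodable :: "bit mat \<Rightarrow> nat set \<Rightarrow> bool"
  where "decodable A S \<longleftrightarrow> full_row_rank (submatrix A UNIV S)"

text \<open>
  If \<open>A \<in> generator_matrices n k\<close> and \<open>k \<ge> 1\<close>, the set below is nonempty, bounded below
  and contains its infimum, which is thus the first time of decodability.
\<close>

definition completion_time :: "nat \<Rightarrow> bit mat \<Rightarrow> (nat \<Rightarrow> real) \<Rightarrow> real"
  where "completion_time n A \<tau> = Inf {t. decodable A {i. i < n \<and> \<tau> i \<le> t}}"

definition run_time_cdf :: "nat \<Rightarrow> real \<Rightarrow> real \<Rightarrow> real"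
  where "run_time_cdf k \<mu> t = (if t \<ge> 1 / real k then 1 - exp (- \<mu> * (real k * t - 1)) else 0)"

text \<open>
  Independence of two random variables whose ranges may have different types
  (\<^const>\<open>prob_space.indep_var\<close> requires equal types).
\<close>

definition (in prob_space) indep_pair ::
    "'b measure \<Rightarrow> ('a \<Rightarrow> 'b) \<Rightarrow> 'c measure \<Rightarrow> ('a \<Rightarrow> 'c) \<Rightarrow> bool"
  where "indep_pair Ma X Mb Y \<longleftrightarrow>
    random_variable Ma X \<and> random_variable Mb Y \<and>
    indep_set {X -` A \<inter> space M | A. A \<in> sets Ma} {Y -` B \<inter> space M | B. B \<in> sets Mb}"

definition p_f :: "nat \<Rightarrow> nat \<Rightarrow> nat \<Rightarrow> real"
  where "p_f n i k = 1 -
    (\<Prod>j = 1..k. 1 - 2 powi (int j - 1 - int n + int i)) /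
    (\<Prod>l = 1..k. 1 - 2 powi (int l - 1 - int n))"

end

theory Submission
  imports Defs "HOL-Real_Asymp.Real_Asymp"
begin

text \<open>
  For a full-rank generator matrix the job is unfinished at time \<open>t\<close> iff the columns of the servers
  finished by then do not have full row rank. A matrix has full row rank on the columns in \<open>S\<close> iff
  its rows, restricted to \<open>S\<close>, are linearly independent; choosing the rows one after the other,
  each outside the span of its predecessors, counts such matrices, and shows that the failure
  probability is \<open>p_f n i k\<close> with \<open>i = n - |S|\<close>. With \<open>F\<close> the common distribution function of the run
  times, independence gives
  \<open>P(T > t) = \<Sum>i\<le>n. (n choose i) F(t)^(n-i) (1 - F(t))^i p_f n i k\<close>.
  Integrating over \<open>t \<ge> 0\<close>, the time before \<open>1/k\<close> contributes \<open>1/k\<close>, and afterwards the \<open>i\<close>-th term is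
  a beta integral equal to \<open>p_f n i k / (i \<mu> k)\<close>. Finally \<open>p_f n i k = 1\<close> for \<open>i > n - k\<close>.
\<close>

unbundle no inner_syntax

section \<open>Rank and the left kernel\<close>

text \<open>A column outside the span of \<open>U\<close> could be added to \<open>U\<close> without
  creating a dependence, against maximality.\<close>

lemma (in vec_space) cols_subset_span_maximal:
  assumes A: "A \<in> carrier_mat n nc"
    and U: "maximal U (\<lambda>T. T \<subseteq> set (cols A) \<and> lin_indpt T)"
  shows "set (cols A) \<subseteq> span U"
proof
  fix c assume c: "c \<in> set (cols A)"
  have carr: "set (cols A) \<subseteq> carrier_vec n" using A cols_dim by blast
  have UA: "U \<subseteq> set (cols A)" and li: "lin_indpt U"
    using U by (auto simp: maximal_def)
  show "c \<in> span U"
  proof (cases "c \<in> U")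
    case True
    then show ?thesis using UA carr by (meson span_mem subset_trans)
  next
    case False
    have "lin_dep (U \<union> {c})"
    proof (rule ccontr)
      assume "\<not> lin_dep (U \<union> {c})"
      with U c UA have "U \<union> {c} = U" unfolding maximal_def by blast
      with False show False by blast
    qed
    then show ?thesis
      using lin_dep_iff_in_span[of U c] UA carr c li False by blast
  qed
qed

text \<open>The vectors orthogonal to \<open>x\<close> form a submodule; it contains
  \<open>U\<close> and hence the span of \<open>U\<close>.\<close>

lemma (in vec_space) orthogonal_span:
  assumes U: "U \<subseteq> carrier_vec n" and x: "x \<in> carrier_vec n"
    and orth: "\<And>u. u \<in> U \<Longrightarrow> x \<bullet> u = 0" and v: "v \<in> span U"
  shows "x \<bullet> v = 0"
proof -
  let ?N = "{v \<in> carrier_vec n. x \<bullet> v = 0}"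
  have "submodule class_ring ?N V"
    by unfold_locales
      (auto simp: x class_ring_simps module_vec_simps scalar_prod_add_distrib[OF x])
  then have "span U \<subseteq> ?N"
    using U orth by (intro span_is_subset) auto
  then show ?thesis using v by blast
qed

text \<open>
  A maximal independent set of columns, padded with zero columns to a square matrix \<open>B\<close>, turns the
  claim into \<open>det B = det B\<^sup>T\<close>.
\<close>

lemma (in vec_space) rank_eq_dim_iff:
  assumes A: "A \<in> carrier_mat n nc"
  shows "rank A = n \<longleftrightarrow>
    (\<forall>x \<in> carrier_vec n. (\<forall>v \<in> set (cols A). x \<bullet> v = 0) \<longrightarrow> x = 0\<^sub>v n)"
proof -
  obtain U where U: "maximal U (\<lambda>T. T \<subseteq> set (cols A) \<and> lin_indpt T)"
    using maximal_exists_superset[of "set (cols A)" "\<lambda>T. T \<subseteq> set (cols A) \<and> lin_indpt T" "{}"]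
    by (auto simp: finite_lin_indpt2)
  have carr: "set (cols A) \<subseteq> carrier_vec n" using A cols_dim by blast
  have UA: "U \<subseteq> set (cols A)" and li: "lin_indpt U"
    using U by (auto simp: maximal_def)
  have Uc: "U \<subseteq> carrier_vec n" using UA carr by blast
  have finU: "finite U" using UA finite_subset by blast
  obtain us where us: "set us = U" "distinct us" "length us = card U"
    using finite_distinct_list[OF finU] distinct_card by metis
  have rk: "rank A = card U" by (rule rank_card_indpt[OF A U])
  have le: "card U \<le> n" using li_le_dim(2)[OF fin_dim] Uc li dim_is_n by auto
  define ws where "ws = us @ replicate (n - card U) (0\<^sub>v n)"
  have lws: "length ws = n" using us le by (simp add: ws_def)
  define B where "B = mat_of_cols n ws"
  have B: "B \<in> carrier_mat n n" using lws by (simp add: B_def mat_of_cols_def)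
  have colsB: "cols B = ws"
    unfolding B_def by (rule cols_mat_of_cols) (use us Uc in \<open>auto simp: ws_def\<close>)
  have BT: "transpose_mat B *\<^sub>v x = 0\<^sub>v n \<longleftrightarrow> (\<forall>u\<in>U. x \<bullet> u = 0)"
    if x: "x \<in> carrier_vec n" for x
  proof -
    have "transpose_mat B *\<^sub>v x = 0\<^sub>v n \<longleftrightarrow> (\<forall>i<n. col B i \<bullet> x = 0)"
      using B by (auto simp: vec_eq_iff)
    also have "\<dots> \<longleftrightarrow> (\<forall>w\<in>set ws. w \<bullet> x = 0)"
      using B lws by (auto simp: colsB[symmetric] cols_def)
    also have "\<dots> \<longleftrightarrow> (\<forall>u\<in>U. u \<bullet> x = 0)"
      using us x by (auto simp: ws_def)
    also have "\<dots> \<longleftrightarrow> (\<forall>u\<in>U. x \<bullet> u = 0)"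
      using x Uc comm_scalar_prod[of x n] by (metis subsetD)
    finally show ?thesis .
  qed
  have det: "det B = 0 \<longleftrightarrow> (\<exists>x\<in>carrier_vec n. x \<noteq> 0\<^sub>v n \<and> (\<forall>u\<in>U. x \<bullet> u = 0))"
    using det_0_iff_vec_prod_zero_field[of "transpose_mat B" n] B BT
    by (auto simp: det_transpose)
  \<comment> \<open>If \<open>U\<close> has fewer than \<open>n\<close> elements, the last column of
    \<open>B\<close> is padding, so \<open>B\<close> annihilates the last unit vector. Otherwise
    there is no padding and the columns of \<open>B\<close> are \<open>n\<close> independent
    vectors.\<close>
  have "det B = 0 \<longleftrightarrow> card U < n"
  proof
    assume lt: "card U < n"
    have "B *\<^sub>v unit_vec n (n - 1) = col B (n - 1)"
      using B lt by (intro eq_vecI) (auto simp: scalar_prod_right_unit)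
    also have "\<dots> = ws ! (n - 1)"
      using B lt cols_nth[of "n - 1" B] colsB by simp
    also have "\<dots> = 0\<^sub>v n"
    proof -
      have "\<not> n - 1 < length us" "n - 1 - length us < n - card U" using lt us by auto
      then show ?thesis unfolding ws_def nth_append by simp
    qed
    finally have "B *\<^sub>v unit_vec n (n - 1) = 0\<^sub>v n" .
    moreover have "unit_vec n (n - 1) \<noteq> (0\<^sub>v n :: 'a vec)" using lt by simp
    ultimately show "det B = 0"
      using det_0_iff_vec_prod_zero_field[OF B] unit_vec_carrier by blast
  next
    assume d: "det B = 0"
    show "card U < n"
    proof (rule ccontr)
      assume "\<not> card U < n"
      then have "ws = us" by (simp add: ws_def)
      then have "rank B = n"
        using lin_indpt_full_rank[OF B] colsB us li by simp
      then show False using det_zero_low_rank[OF B d] by simp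
    qed
  qed
  \<comment> \<open>All columns lie in the span of \<open>U\<close>, so orthogonality to
    \<open>U\<close> already gives orthogonality to every column.\<close>
  moreover have perp: "(\<forall>v \<in> set (cols A). x \<bullet> v = 0) \<longleftrightarrow> (\<forall>u\<in>U. x \<bullet> u = 0)"
    if "x \<in> carrier_vec n" for x
    using orthogonal_span[OF Uc that] cols_subset_span_maximal[OF A U] UA
    by (meson subsetD)
  ultimately have "rank A = n \<longleftrightarrow> \<not> (\<exists>x\<in>carrier_vec n. x \<noteq> 0\<^sub>v n \<and> (\<forall>u\<in>U. x \<bullet> u = 0))"
    unfolding rk det using le by linarith
  then show ?thesis using perp by blast
qed

section \<open>Counting matrices with independent rows\<close>

text \<open>Entries are given by a function on all index pairs instead of a matrix, so that adding a
  row or restricting to the columns in \<open>S\<close> changes no dimension.\<close>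

definition rows_independent :: "nat \<Rightarrow> (nat \<Rightarrow> nat \<Rightarrow> 'a::field) \<Rightarrow> nat set \<Rightarrow> bool"
  where "rows_independent k A S \<longleftrightarrow>
    (\<forall>x. (\<forall>j\<in>S. (\<Sum>i<k. x i * A i j) = 0) \<longrightarrow> (\<forall>i<k. x i = 0))"

lemma rows_independent_cong:
  assumes "\<And>i j. i < k \<Longrightarrow> j \<in> S \<Longrightarrow> A i j = B i j"
  shows "rows_independent k A S \<longleftrightarrow> rows_independent k B S"
  using assms by (simp add: rows_independent_def)

lemma rows_independent_mono:
  assumes "rows_independent k A S" "S \<subseteq> S'"
  shows "rows_independent k A S'"
  using assms unfolding rows_independent_def by blast

text \<open>In a vanishing combination of the first \<open>k + 1\<close> rows the last coefficient
  must be 0, since dividing by it would express row \<open>k\<close> through the earlier rows. This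
  makes it possible to count row by row.\<close>

lemma rows_independent_Suc:
  "rows_independent (Suc k) A S \<longleftrightarrow>
    rows_independent k A S \<and> (\<nexists>x. \<forall>j\<in>S. A k j = (\<Sum>i<k. x i * A i j))"
proof (intro iffI conjI)
  assume L: "rows_independent (Suc k) A S"
  show "rows_independent k A S"
    unfolding rows_independent_def
  proof (rule allI, rule impI)
    fix x assume x: "\<forall>j\<in>S. (\<Sum>i<k. x i * A i j) = 0"
    \<comment> \<open>The value \<open>x k\<close> is arbitrary, so it is set to 0 before the longer
      combination is formed.\<close>
    let ?y = "x(k := 0)"
    have "\<forall>j\<in>S. (\<Sum>i<Suc k. ?y i * A i j) = 0"
      using x by simp
    with L have "\<forall>i<Suc k. ?y i = 0" unfolding rows_independent_def by blast
    then show "\<forall>i<k. x i = 0" by (metis fun_upd_other less_Suc_eq less_not_refl)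
  qed
  show "\<nexists>x. \<forall>j\<in>S. A k j = (\<Sum>i<k. x i * A i j)"
  proof
    assume "\<exists>x. \<forall>j\<in>S. A k j = (\<Sum>i<k. x i * A i j)"
    then obtain x where x: "\<forall>j\<in>S. A k j = (\<Sum>i<k. x i * A i j)" by blast
    let ?y = "x(k := -1)"
    have "\<forall>j\<in>S. (\<Sum>i<Suc k. ?y i * A i j) = 0"
      using x by simp
    with L have "?y k = 0" unfolding rows_independent_def by blast
    then show False by simp
  qed
next
  assume R: "rows_independent k A S \<and> (\<nexists>x. \<forall>j\<in>S. A k j = (\<Sum>i<k. x i * A i j))"
  show "rows_independent (Suc k) A S"
    unfolding rows_independent_def
  proof (rule allI, rule impI)
    fix x assume x: "\<forall>j\<in>S. (\<Sum>i<Suc k. x i * A i j) = 0"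
    have k0: "x k = 0"
    proof (rule ccontr)
      assume ne: "x k \<noteq> 0"
      have "A k j = (\<Sum>i<k. (- x i / x k) * A i j)" if "j \<in> S" for j
      proof -
        have "(\<Sum>i<k. x i * A i j) = - (x k * A k j)"
          using x that by (simp add: eq_neg_iff_add_eq_0)
        moreover have "(\<Sum>i<k. (- x i / x k) * A i j) = - (\<Sum>i<k. x i * A i j) / x k"
          by (simp add: sum_divide_distrib sum_negf)
        ultimately show ?thesis using ne by simp
      qed
      then have "\<exists>x. \<forall>j\<in>S. A k j = (\<Sum>i<k. x i * A i j)"
        by (intro exI[of _ "\<lambda>i. - x i / x k"] ballI)
      with R show False by simp
    qed
    then have "\<forall>j\<in>S. (\<Sum>i<k. x i * A i j) = 0" using x by simp
    with R have "\<forall>i<k. x i = 0" unfolding rows_independent_def by blast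
    with k0 show "\<forall>i<Suc k. x i = 0" by (simp add: less_Suc_eq)
  qed
qed

lemma rows_independent_inj:
  assumes ind: "rows_independent k A S"
    and eq: "\<And>j. j \<in> S \<Longrightarrow> (\<Sum>i<k. x i * A i j) = (\<Sum>i<k. y i * A i j)" and i: "i < k"
  shows "x i = y i"
proof -
  have "\<forall>j\<in>S. (\<Sum>i<k. (x i - y i) * A i j) = 0"
    using eq by (simp add: left_diff_distrib sum_subtractf)
  then have "\<forall>i<k. x i - y i = 0"
    using ind[unfolded rows_independent_def, THEN spec, of "\<lambda>i. x i - y i"] by simp
  with i show ?thesis by simp
qed

text \<open>On \<open>S\<close> such a row is a combination of the \<open>k\<close> given rows, with
  unique coefficients by independence; outside \<open>S\<close> its entries are free. The map
  \<open>?f\<close> builds the row from these two independent choices.\<close>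

lemma card_dependent_rows:
  fixes A :: "nat \<Rightarrow> nat \<Rightarrow> 'a::field"
  assumes ind: "rows_independent k A S" and S: "S \<subseteq> {..<n}"
  shows "card {r \<in> {..<n} \<rightarrow>\<^sub>E UNIV. \<exists>x. \<forall>j\<in>S. r j = (\<Sum>i<k. x i * A i j)} =
    CARD('a) ^ k * CARD('a) ^ (n - card S)"
proof -
  let ?f = "\<lambda>(x, z). \<lambda>j\<in>{..<n}. if j \<in> S then \<Sum>i<k. x i * A i j else z j"
  let ?D = "({..<k} \<rightarrow>\<^sub>E (UNIV :: 'a set)) \<times> (({..<n} - S) \<rightarrow>\<^sub>E (UNIV :: 'a set))"
  let ?E = "{r \<in> {..<n} \<rightarrow>\<^sub>E UNIV. \<exists>x. \<forall>j\<in>S. r j = (\<Sum>i<k. x i * A i j)}"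
  have "inj_on ?f ?D"
  proof (rule inj_onI, clarify)
    fix x z x' z'
    assume x: "x \<in> {..<k} \<rightarrow>\<^sub>E (UNIV :: 'a set)" "x' \<in> {..<k} \<rightarrow>\<^sub>E (UNIV :: 'a set)"
      and z: "z \<in> ({..<n} - S) \<rightarrow>\<^sub>E (UNIV :: 'a set)" "z' \<in> ({..<n} - S) \<rightarrow>\<^sub>E (UNIV :: 'a set)"
      and eq: "(\<lambda>j\<in>{..<n}. if j \<in> S then \<Sum>i<k. x i * A i j else z j) =
        (\<lambda>j\<in>{..<n}. if j \<in> S then \<Sum>i<k. x' i * A i j else z' j)"
    have eq': "(if j \<in> S then \<Sum>i<k. x i * A i j else z j) =
        (if j \<in> S then \<Sum>i<k. x' i * A i j else z' j)" if "j < n" for j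
      using fun_cong[OF eq, of j] that by simp
    have "x i = x' i" if "i < k" for i
      by (rule rows_independent_inj[OF ind _ that]) (use eq' S in fastforce)
    then have "x = x'" using x by (intro PiE_ext[of x _ _ x']) auto
    moreover have "z = z'"
      using z by (rule PiE_ext) (use eq' in fastforce)
    ultimately show "x = x' \<and> z = z'" by simp
  qed
  moreover have "?f ` ?D = ?E"
  proof (intro equalityI subsetI)
    fix r assume "r \<in> ?f ` ?D"
    then obtain x z where r: "r = (\<lambda>j\<in>{..<n}. if j \<in> S then \<Sum>i<k. x i * A i j else z j)" by auto
    then have "\<forall>j\<in>S. r j = (\<Sum>i<k. x i * A i j)" using S by auto
    then show "r \<in> ?E" using r by auto
  next
    fix r assume "r \<in> ?E"
    then obtain x where r: "r \<in> {..<n} \<rightarrow>\<^sub>E UNIV" and x: "\<forall>j\<in>S. r j = (\<Sum>i<k. x i * A i j)" by blast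
    have "r j = ?f (restrict x {..<k}, restrict r ({..<n} - S)) j" for j
    proof (cases "j < n")
      case True
      then show ?thesis using x by simp
    next
      case False
      then show ?thesis using PiE_arb[OF r] by simp
    qed
    then have "r = ?f (restrict x {..<k}, restrict r ({..<n} - S))" by (rule ext)
    moreover have "(restrict x {..<k}, restrict r ({..<n} - S)) \<in> ?D" by simp
    ultimately show "r \<in> ?f ` ?D" by (rule image_eqI)
  qed
  ultimately have "bij_betw ?f ?D ?E" unfolding bij_betw_def by (rule conjI)
  then have "card ?E = card ?D" by (rule bij_betw_same_card[symmetric])
  also have "\<dots> = CARD('a) ^ k * CARD('a) ^ (n - card S)"
    using S by (simp add: card_cartesian_product card_PiE card_Diff_subset finite_subset)
  finally show ?thesis .
qed

text \<open>Induction on the number of rows: of the \<open>q^n\<close> candidates for row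
  \<open>k\<close>, with \<open>q\<close> the size of the field, exactly
  \<open>q^k * q^(n - card S)\<close> depend on the earlier rows. Subtraction takes place in the
  reals; for \<open>k > card S\<close> the factor \<open>j = card S\<close> is 0, as it should
  be.\<close>

lemma card_rows_independent:
  assumes fin: "finite (UNIV :: 'a::field set)" and S: "S \<subseteq> {..<n}"
  shows "real (card {A \<in> {..<k} \<rightarrow>\<^sub>E ({..<n} \<rightarrow>\<^sub>E (UNIV :: 'a set)). rows_independent k A S}) =
    (\<Prod>j<k. real CARD('a) ^ (n - card S) * (real CARD('a) ^ card S - real CARD('a) ^ j))"
proof (induction k)
  case 0
  have "{A \<in> {..<0::nat} \<rightarrow>\<^sub>E ({..<n} \<rightarrow>\<^sub>E (UNIV :: 'a set)). rows_independent 0 A S} = {\<lambda>_. undefined}"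
    by (auto simp: rows_independent_def)
  then show ?case by simp
next
  case (Suc k)
  let ?q = "real CARD('a)"
  let ?P = "{..<n} \<rightarrow>\<^sub>E (UNIV :: 'a set)"
  let ?R = "\<lambda>k. {A \<in> {..<k} \<rightarrow>\<^sub>E ?P. rows_independent k A S}"
  let ?E = "\<lambda>A. {r \<in> ?P. \<exists>x. \<forall>j\<in>S. r j = (\<Sum>i<k. x i * A i j)}"
  have finP: "finite ?P" using fin by (intro finite_PiE) auto
  have finR: "finite (?R k)"
    by (rule finite_subset[of _ "{..<k} \<rightarrow>\<^sub>E ?P"]) (use finP in \<open>auto intro!: finite_PiE\<close>)
  let ?f = "\<lambda>(A, r). A(k := r)"
  have cS: "card S \<le> n" using card_mono[OF _ S] by simp
  \<comment> \<open>The choices for the new row depend on the rows before it, hence a dependent sum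
    rather than a product.\<close>
  have "?R (Suc k) = ?f ` (SIGMA A:?R k. ?P - ?E A)"
  proof (intro equalityI subsetI)
    fix A assume A: "A \<in> ?R (Suc k)"
    \<comment> \<open>Functions in \<open>PiE\<close> are \<open>undefined\<close> outside their
      domain, so removing row \<open>k\<close> means resetting it to that value.\<close>
    let ?A = "A(k := undefined)"
    have "rows_independent k ?A S"
      using A rows_independent_Suc[of k A S] rows_independent_cong[of k S A ?A] by simp
    moreover have "?A \<in> {..<k} \<rightarrow>\<^sub>E ?P"
      using A by (auto simp: PiE_iff extensional_def less_Suc_eq)
    moreover have "A k \<in> ?P"
      using A by (auto simp: PiE_iff)
    moreover have "A k \<notin> ?E ?A"
    proof -
      have "(\<Sum>i<k. x i * ?A i j) = (\<Sum>i<k. x i * A i j)" for x j by simp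
      moreover have "\<nexists>x. \<forall>j\<in>S. A k j = (\<Sum>i<k. x i * A i j)"
        using A rows_independent_Suc[of k A S] by blast
      ultimately show ?thesis by (simp only: mem_Collect_eq simp_thms)
    qed
    ultimately have "(?A, A k) \<in> (SIGMA A:?R k. ?P - ?E A)"
      by (intro SigmaI DiffI CollectI conjI)
    moreover have "A = ?f (?A, A k)" by auto
    ultimately show "A \<in> ?f ` (SIGMA A:?R k. ?P - ?E A)" by (rule rev_image_eqI)
  next
    fix B assume "B \<in> ?f ` (SIGMA A:?R k. ?P - ?E A)"
    then obtain p where Bp: "B = ?f p" and p: "p \<in> (SIGMA A:?R k. ?P - ?E A)"
      by (rule imageE)
    from p obtain A r where A: "A \<in> ?R k" and r': "r \<in> ?P - ?E A" and pAr: "p = (A, r)"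
      by (rule SigmaE)
    have B: "B = A(k := r)" using Bp pAr by simp
    have r1: "r \<in> ?P" by (fact DiffD1[OF r'])
    have r2: "\<nexists>x. \<forall>j\<in>S. r j = (\<Sum>i<k. x i * A i j)"
      using DiffD2[OF r'] r1 by blast
    have "rows_independent k B S"
      using A rows_independent_cong[of k S A B] by (simp add: B)
    moreover have "\<nexists>x. \<forall>j\<in>S. B k j = (\<Sum>i<k. x i * B i j)"
      using r2 by (simp add: B)
    ultimately have "rows_independent (Suc k) B S" using rows_independent_Suc by blast
    moreover have "B \<in> {..<Suc k} \<rightarrow>\<^sub>E ?P"
      using A r1 by (auto simp: B PiE_iff extensional_def less_Suc_eq)
    ultimately show "B \<in> ?R (Suc k)" by blast
  qed
  moreover have "inj_on ?f (SIGMA A:?R k. ?P - ?E A)"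
  proof (rule inj_onI)
    fix p p'
    assume p: "p \<in> (SIGMA A:?R k. ?P - ?E A)" "p' \<in> (SIGMA A:?R k. ?P - ?E A)" "?f p = ?f p'"
    obtain A r A' r' where pp: "p = (A, r)" "p' = (A', r')" by (metis surj_pair)
    have A: "A \<in> {..<k} \<rightarrow>\<^sub>E ?P" "A' \<in> {..<k} \<rightarrow>\<^sub>E ?P"
      using p(1,2) unfolding pp by (blast dest: SigmaD1)+
    have eq: "A(k := r) = A'(k := r')" using p(3) by (simp add: pp)
    have "A i = A' i" if "i < k" for i
      using fun_cong[OF eq, of i] that by simp
    then have "A = A'" using A by (intro PiE_ext[of A _ _ A']) auto
    moreover have "r = r'" using fun_cong[OF eq, of k] by simp
    ultimately show "p = p'" by (simp add: pp)
  qed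
  ultimately have "card (?R (Suc k)) = card (SIGMA A:?R k. ?P - ?E A)"
    using card_image[of ?f "SIGMA A:?R k. ?P - ?E A"] by (simp only:)
  also have "\<dots> = (\<Sum>A\<in>?R k. card (?P - ?E A))"
    using finR finP by (intro card_SigmaI) auto
  finally have "real (card (?R (Suc k))) = (\<Sum>A\<in>?R k. real (card (?P - ?E A)))" by simp
  also have "\<dots> = (\<Sum>A\<in>?R k. ?q ^ (n - card S) * (?q ^ card S - ?q ^ k))"
  proof (rule sum.cong[OF refl])
    fix A assume A: "A \<in> ?R k"
    have sub: "?E A \<subseteq> ?P" by blast
    have "real (card (?P - ?E A)) = real (card ?P) - real (card (?E A))"
      using card_Diff_subset[OF finite_subset[OF sub finP] sub] card_mono[OF finP sub]
      by (simp add: of_nat_diff)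
    also have "\<dots> = ?q ^ n - ?q ^ k * ?q ^ (n - card S)"
      using A card_dependent_rows[OF _ S, of k A] by (simp add: card_PiE)
    also have "?q ^ n = ?q ^ (n - card S) * ?q ^ card S"
      using cS by (simp flip: power_add)
    finally show "real (card (?P - ?E A)) = ?q ^ (n - card S) * (?q ^ card S - ?q ^ k)"
      by (simp add: algebra_simps)
  qed
  finally show ?case by (simp add: Suc.IH)
qed

section \<open>Decoding failure of random codes\<close>

text \<open>The products of \<open>x\<close> with the columns are the entries of the combination of
  the rows with coefficients \<open>x\<close>. The triviality of the left kernel, which
  characterises full row rank, is thus independence of the rows.\<close>

lemma full_row_rank_iff_rows_independent:
  assumes A: "A \<in> carrier_mat k n"
  shows "full_row_rank A \<longleftrightarrow> rows_independent k (\<lambda>i j. A $$ (i, j)) {..<n}"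
proof -
  interpret vec_space "TYPE(bit)" k .
  have sp: "x \<bullet> col A j = (\<Sum>i<k. x $ i * A $$ (i, j))" if "j < n" for x j
    using A that by (auto simp: scalar_prod_def atLeast0LessThan intro!: sum.cong)
  have cols: "(\<forall>v\<in>set (cols A). x \<bullet> v = 0) \<longleftrightarrow> (\<forall>j\<in>{..<n}. (\<Sum>i<k. x $ i * A $$ (i, j)) = 0)" for x
    using A sp by (auto simp: cols_def)
  have "full_row_rank A \<longleftrightarrow>
      (\<forall>x\<in>carrier_vec k. (\<forall>v\<in>set (cols A). x \<bullet> v = 0) \<longrightarrow> x = 0\<^sub>v k)"
    using rank_eq_dim_iff[OF A] A by (simp add: full_row_rank_def)
  also have "\<dots> \<longleftrightarrow> rows_independent k (\<lambda>i j. A $$ (i, j)) {..<n}"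
  proof
    assume L: "\<forall>x\<in>carrier_vec k. (\<forall>v\<in>set (cols A). x \<bullet> v = 0) \<longrightarrow> x = 0\<^sub>v k"
    show "rows_independent k (\<lambda>i j. A $$ (i, j)) {..<n}"
      unfolding rows_independent_def
    proof (rule allI, rule impI)
      fix x assume x: "\<forall>j\<in>{..<n}. (\<Sum>i<k. x i * A $$ (i, j)) = 0"
      then have "\<forall>v\<in>set (cols A). vec k x \<bullet> v = 0" unfolding cols by simp
      then have v0: "vec k x = 0\<^sub>v k" using L by simp
      show "\<forall>i<k. x i = 0"
      proof (intro allI impI)
        fix i assume "i < k"
        then show "x i = 0" using arg_cong[OF v0, of "\<lambda>v. v $ i"] by simp
      qed
    qed
  next
    assume R: "rows_independent k (\<lambda>i j. A $$ (i, j)) {..<n}"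
    show "\<forall>x\<in>carrier_vec k. (\<forall>v\<in>set (cols A). x \<bullet> v = 0) \<longrightarrow> x = 0\<^sub>v k"
    proof (intro ballI impI)
      fix x assume x: "x \<in> carrier_vec k" "\<forall>v\<in>set (cols A). x \<bullet> v = 0"
      have "\<forall>j\<in>{..<n}. (\<Sum>i<k. x $ i * A $$ (i, j)) = 0"
        using x(2) by (simp only: cols)
      then have "\<forall>i<k. x $ i = 0"
        by (rule R[unfolded rows_independent_def, THEN spec, THEN mp, of "($) x"])
      then show "x = 0\<^sub>v k" using x by (intro eq_vecI) auto
    qed
  qed
  finally show ?thesis .
qed

text \<open>\<open>submatrix\<close> only renumbers the columns in \<open>S\<close> through
  \<open>pick S\<close>, which maps \<open>{..<card S}\<close> onto \<open>S\<close>. The condition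
  of row independence does not see the numbering.\<close>

lemma decodable_iff_rows_independent:
  assumes A: "A \<in> carrier_mat k n" and S: "S \<subseteq> {..<n}"
  shows "decodable A S \<longleftrightarrow> rows_independent k (\<lambda>i j. A $$ (i, j)) S"
proof -
  have finS: "finite S" using S finite_subset by blast
  have cS: "{j. j < n \<and> j \<in> S} = S" using S by auto
  have sub: "submatrix A UNIV S \<in> carrier_mat k (card S)"
    using A by (auto simp: dim_submatrix cS)
  have "pick S ` {..<card S} = S"
  proof (intro equalityI subsetI)
    fix j assume "j \<in> pick S ` {..<card S}"
    then show "j \<in> S" using pick_in_set_le by auto
  next
    fix j assume j: "j \<in> S"
    \<comment> \<open>The position of \<open>j\<close> in the enumeration of \<open>S\<close> is the
      number of smaller elements of \<open>S\<close>.\<close>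
    then have "card {a \<in> S. a < j} < card S"
      by (intro psubset_card_mono finS) auto
    then show "j \<in> pick S ` {..<card S}"
      by (intro image_eqI[where f = "pick S" and x = "card {a \<in> S. a < j}"])
        (simp_all add: pick_card_in_set[OF j])
  qed
  then have "rows_independent k (\<lambda>i j. A $$ (i, j)) S \<longleftrightarrow>
      rows_independent k (\<lambda>i j. A $$ (i, j)) (pick S ` {..<card S})"
    by simp
  also have "\<dots> \<longleftrightarrow> rows_independent k (\<lambda>i j. A $$ (i, pick S j)) {..<card S}"
    by (simp add: rows_independent_def)
  also have "\<dots> \<longleftrightarrow> rows_independent k (\<lambda>i j. submatrix A UNIV S $$ (i, j)) {..<card S}"
    using A by (intro rows_independent_cong) (auto simp: submatrix_index cS pick_UNIV)
  also have "\<dots> \<longleftrightarrow> decodable A S"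
    unfolding decodable_def by (rule full_row_rank_iff_rows_independent[OF sub, symmetric])
  finally show ?thesis by simp
qed

lemma decodable_mono:
  assumes "A \<in> carrier_mat k n" "decodable A S" "S \<subseteq> S'" "S' \<subseteq> {..<n}"
  shows "decodable A S'"
  using assms decodable_iff_rows_independent[OF assms(1)] rows_independent_mono
  by (metis subset_trans)

text \<open>Without columns every combination of rows vanishes, in particular the one with all
  coefficients 1, and \<open>k >= 1\<close> provides at least one coefficient.\<close>

lemma not_decodable_empty:
  assumes "A \<in> carrier_mat k n" "1 \<le> k"
  shows "\<not> decodable A {}"
proof
  assume "decodable A {}"
  then have "\<forall>i<k. (1::bit) = 0"
    using decodable_iff_rows_independent[OF assms(1), of "{}"]
    by (auto simp: rows_independent_def)
  then show False using assms(2) by auto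
qed

text \<open>With full rank seen as decodability from all columns, one count yields both the size of
  the ensemble and the number of its members that decode from \<open>S\<close>.\<close>

lemma generator_matrices_decodable:
  "generator_matrices n k = {A \<in> carrier_mat k n. decodable A {..<n}}"
  using full_row_rank_iff_rows_independent decodable_iff_rows_independent
  by (auto simp: generator_matrices_def)

text \<open>Matrices correspond bijectively to extensional families of rows, so the count of
  independent rows applies with a field of two elements.\<close>

lemma card_carrier_mat_decodable:
  assumes S: "S \<subseteq> {..<n}"
  shows "real (card {A \<in> carrier_mat k n. decodable A S}) =
    (\<Prod>j<k. 2 ^ (n - card S) * (2 ^ card S - 2 ^ j))"
proof -
  have UNIV_bit: "(UNIV :: bit set) = {0, 1}" using bit_not_zero_iff by auto
  have fin: "finite (UNIV :: bit set)" unfolding UNIV_bit by simp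
  have card_bit: "CARD(bit) = 2" unfolding UNIV_bit by simp
  let ?F = "{F \<in> {..<k} \<rightarrow>\<^sub>E ({..<n} \<rightarrow>\<^sub>E (UNIV :: bit set)). rows_independent k F S}"
  let ?A = "{A \<in> carrier_mat k n. decodable A S}"
  have "bij_betw (\<lambda>F. mat k n (\<lambda>(i, j). F i j)) ?F ?A"
  proof (rule bij_betwI[where g = "\<lambda>A. \<lambda>i\<in>{..<k}. \<lambda>j\<in>{..<n}. A $$ (i, j)"])
    show "(\<lambda>F. mat k n (\<lambda>(i, j). F i j)) \<in> ?F \<rightarrow> ?A"
    proof
      fix F :: "nat \<Rightarrow> nat \<Rightarrow> bit" assume F: "F \<in> ?F"
      have "rows_independent k (\<lambda>i j. mat k n (\<lambda>(i, j). F i j) $$ (i, j)) S \<longleftrightarrow> rows_independent k F S"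
        using S by (intro rows_independent_cong) auto
      then show "mat k n (\<lambda>(i, j). F i j) \<in> ?A"
        using F decodable_iff_rows_independent[OF _ S, of "mat k n (\<lambda>(i, j). F i j)" k] by simp
    qed
    show "(\<lambda>A. \<lambda>i\<in>{..<k}. \<lambda>j\<in>{..<n}. A $$ (i, j)) \<in> ?A \<rightarrow> ?F"
    proof
      fix A assume A: "A \<in> ?A"
      have "rows_independent k (\<lambda>i\<in>{..<k}. \<lambda>j\<in>{..<n}. A $$ (i, j)) S \<longleftrightarrow>
          rows_independent k (\<lambda>i j. A $$ (i, j)) S"
        using S by (intro rows_independent_cong) auto
      then show "(\<lambda>i\<in>{..<k}. \<lambda>j\<in>{..<n}. A $$ (i, j)) \<in> ?F"
        using A decodable_iff_rows_independent[OF _ S, of A k] by auto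
    qed
    fix F assume F: "F \<in> ?F"
    show "(\<lambda>i\<in>{..<k}. \<lambda>j\<in>{..<n}. mat k n (\<lambda>(i, j). F i j) $$ (i, j)) = F"
    proof (rule ext, rule ext)
      fix i j
      have FP: "F \<in> {..<k} \<rightarrow>\<^sub>E ({..<n} \<rightarrow>\<^sub>E (UNIV :: bit set))" using F by simp
      show "(\<lambda>i\<in>{..<k}. \<lambda>j\<in>{..<n}. mat k n (\<lambda>(i, j). F i j) $$ (i, j)) i j = F i j"
      proof (cases "i < k")
        case True
        then have "F i \<in> {..<n} \<rightarrow>\<^sub>E UNIV" using FP by auto
        then show ?thesis using True PiE_arb[of "F i" "{..<n}" "\<lambda>_. UNIV" j] by (cases "j < n") auto
      next
        case False
        then show ?thesis using PiE_arb[OF FP, of i] by simp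
      qed
    qed
  next
    fix A assume A: "A \<in> ?A"
    then show "mat k n (\<lambda>(i, j). (\<lambda>i\<in>{..<k}. \<lambda>j\<in>{..<n}. A $$ (i, j)) i j) = A"
      by (intro eq_matI) auto
  qed
  then have "card ?F = card ?A" by (rule bij_betw_same_card)
  then show ?thesis
    using card_rows_independent[OF fin S, of k] by (simp add: card_bit)
qed

lemma card_generator_matrices:
  "real (card (generator_matrices n k)) = (\<Prod>j<k. 2 ^ n - 2 ^ j)"
  using card_carrier_mat_decodable[of "{..<n}" n k] by (simp add: generator_matrices_decodable)

lemma card_generator_matrices_pos:
  assumes "k \<le> n"
  shows "0 < card (generator_matrices n k)"
proof -
  have "(0::real) < (\<Prod>j<k. 2 ^ n - 2 ^ j)"
    using assms by (intro prod_pos) simp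
  then show ?thesis using card_generator_matrices[of n k] by simp
qed

lemma finite_generator_matrices:
  assumes "k \<le> n"
  shows "finite (generator_matrices n k)"
  \<comment> \<open>Infinite sets have \<open>card\<close> 0, so a positive cardinality implies
    finiteness.\<close>
  using card_generator_matrices_pos[OF assms] by (rule card_ge_0_finite)

section \<open>Closed form of the failure probability\<close>

lemma p_f_altdef:
  assumes "i \<le> n"
  shows "p_f n i k =
    1 - (\<Prod>j<k. 1 - 2 ^ j / 2 ^ (n - i)) / (\<Prod>j<k. 1 - 2 ^ j / 2 ^ n)"
proof -
  have powi: "(2::real) powi (int j - int m) = 2 ^ j / 2 ^ m" for j m
    by (simp add: power_int_diff)
  \<comment> \<open>Here \<open>i <= n\<close> ensures that the natural number \<open>n - i\<close>
    is not truncated. The index \<open>j\<close> is the one of \<open>p_f\<close> lowered by 1,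
    which absorbs the \<open>- 1\<close> in the exponent.\<close>
  have "int j - int n + int i = int j - int (n - i)" for j
    using assms by simp
  then have "(2::real) powi (int j - int n + int i) = 2 ^ j / 2 ^ (n - i)" for j
    by (simp only: powi)
  then show ?thesis
    by (simp add: p_f_def prod.atLeast1_atMost_eq powi)
qed

lemma p_f_0:
  assumes "k \<le> n"
  shows "p_f n 0 k = 0"
proof -
  have "(\<Prod>j<k. 1 - 2 ^ j / 2 ^ n) \<noteq> (0::real)"
    using assms by (auto simp: prod_zero_iff)
  then show ?thesis by (simp add: p_f_altdef)
qed

text \<open>Fewer than \<open>k\<close> columns cannot have rank \<open>k\<close>. In the formula,
  \<open>n - i < k\<close> makes \<open>j = n - i\<close> one of the indices of the numerator, and
  its factor is 0.\<close>

lemma p_f_eq_1: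
  assumes "n < k + i" "i \<le> n"
  shows "p_f n i k = 1"
proof -
  have "n - i \<in> {..<k}" using assms by auto
  then have "(\<Prod>j<k. 1 - 2 ^ j / 2 ^ (n - i)) = (0::real)"
    by (intro prod_zero) auto
  then show ?thesis using assms by (simp add: p_f_altdef)
qed

text \<open>A matrix that decodes from \<open>S\<close> decodes from all columns, so these matrices
  lie in the ensemble and the failures are their complement. Pulling \<open>2 ^ n\<close> out of
  each of the \<open>k\<close> factors of both counts leaves the quotient in
  \<open>p_f\<close>.\<close>

lemma not_decodable_fraction:
  assumes k: "k \<le> n" and S: "S \<subseteq> {..<n}"
  shows "real (card {A \<in> generator_matrices n k. \<not> decodable A S}) / real (card (generator_matrices n k)) =
    p_f n (n - card S) k"
proof -
  let ?g = "generator_matrices n k"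
  let ?D = "{A \<in> carrier_mat k n. decodable A S}"
  have m: "card S \<le> n" using card_mono[OF _ S] by simp
  have D: "?D \<subseteq> ?g"
    using decodable_mono[of _ k n S "{..<n}"] S by (auto simp: generator_matrices_decodable)
  have fin: "finite ?g" by (rule finite_generator_matrices[OF k])
  have g0: "real (card ?g) \<noteq> 0" using card_generator_matrices_pos[OF k] by simp
  have "{A \<in> ?g. \<not> decodable A S} = ?g - ?D" by (auto simp: generator_matrices_def)
  then have "real (card {A \<in> ?g. \<not> decodable A S}) = real (card ?g) - real (card ?D)"
    using card_Diff_subset[OF finite_subset[OF D fin] D] card_mono[OF fin D] by (simp add: of_nat_diff)
  then have ratio: "real (card {A \<in> ?g. \<not> decodable A S}) / real (card ?g) = 1 - real (card ?D) / real (card ?g)"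
    using g0 by (simp add: diff_divide_distrib)
  have num: "real (card ?D) = (\<Prod>j<k. 2 ^ n * (1 - 2 ^ j / 2 ^ card S))"
    unfolding card_carrier_mat_decodable[OF S]
  proof (rule prod.cong[OF refl])
    fix j
    have "(2::real) ^ n = 2 ^ (n - card S) * 2 ^ card S" using m by (simp flip: power_add)
    then show "(2::real) ^ (n - card S) * (2 ^ card S - 2 ^ j) = 2 ^ n * (1 - 2 ^ j / 2 ^ card S)"
      by (simp add: field_simps)
  qed
  have den: "real (card ?g) = (\<Prod>j<k. 2 ^ n * (1 - 2 ^ j / 2 ^ n))"
    unfolding card_generator_matrices by (simp add: right_diff_distrib)
  have "real (card ?D) / real (card ?g) =
      (\<Prod>j<k. 1 - 2 ^ j / 2 ^ card S) / (\<Prod>j<k. 1 - 2 ^ j / 2 ^ n)"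
    unfolding num den by (simp add: prod.distrib)
  then show ?thesis
    unfolding ratio using m by (simp add: p_f_altdef)
qed

section \<open>Tail integrals\<close>

lemma has_bochner_integral_exp_Ici:
  fixes c a :: real
  assumes c: "c > 0"
  shows "has_bochner_integral lborel (\<lambda>t. indicator {a..} t * exp (- c * (t - a))) (1 / c)"
proof (rule has_bochner_integral_nn_integral)
  have "(\<integral>\<^sup>+t. ennreal (exp (- c * (t - a))) * indicator {a..} t \<partial>lborel) =
      ennreal (0 - (- exp (- c * (a - a)) / c))"
  proof (rule nn_integral_FTC_atLeast[where F="\<lambda>t. - exp (- c * (t - a)) / c"])
    show "((\<lambda>t. - exp (- c * (t - a)) / c) \<longlongrightarrow> 0) at_top"
      using c by real_asymp
  qed (use c in \<open>auto intro!: derivative_eq_intros\<close>)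
  then show "(\<integral>\<^sup>+t. ennreal (indicator {a..} t * exp (- c * (t - a))) \<partial>lborel) = ennreal (1 / c)"
    by (simp add: ennreal_indicator ennreal_mult' mult.commute)
qed (use c in auto)

text \<open>With \<open>u = exp (- c * (t - a))\<close> this is \<open>1 / c\<close> times the beta
  integral of \<open>(1 - u)^m * u^b\<close> over the unit interval. In the induction one factor
  \<open>1 - u\<close> splits the integrand into the cases \<open>(m, b)\<close> and
  \<open>(m, b + 1)\<close>, hence \<open>b\<close> is arbitrary.\<close>

lemma has_bochner_integral_beta_exp:
  fixes c a :: real
  assumes c: "c > 0"
  shows "has_bochner_integral lborel
    (\<lambda>t. indicator {a..} t * ((1 - exp (- c * (t - a))) ^ m * exp (- c * (t - a)) ^ Suc b))
    (fact m * fact b / (fact (m + Suc b) * c))"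
proof (induction m arbitrary: b)
  case 0
  have "real (Suc b) * c > 0" using c by simp
  from has_bochner_integral_exp_Ici[OF this, of a]
  have "has_bochner_integral lborel (\<lambda>t. indicator {a..} t * exp (- c * (t - a)) ^ Suc b) (1 / (real (Suc b) * c))"
    unfolding exp_of_nat_mult[symmetric] by (simp add: algebra_simps)
  then show ?case by (simp add: divide_simps del: of_nat_Suc)
next
  case (Suc m)
  have "has_bochner_integral lborel
    (\<lambda>t. indicator {a..} t * ((1 - exp (- c * (t - a))) ^ m * exp (- c * (t - a)) ^ Suc b) -
         indicator {a..} t * ((1 - exp (- c * (t - a))) ^ m * exp (- c * (t - a)) ^ Suc (Suc b)))
    (fact m * fact b / (fact (m + Suc b) * c) - fact m * fact (Suc b) / (fact (m + Suc (Suc b)) * c))"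
    by (intro has_bochner_integral_diff Suc.IH)
  moreover have "fact m * fact b / (fact (m + Suc b) * c) - fact m * fact (Suc b) / (fact (m + Suc (Suc b)) * c) =
      fact (Suc m) * fact b / (fact (Suc m + Suc b) * c)"
    using c by (simp add: divide_simps) (simp add: algebra_simps)
  ultimately show ?case by (simp add: algebra_simps)
qed

lemma (in sigma_finite_measure) nn_integral_eq_tail:
  fixes X :: "'a \<Rightarrow> real"
  assumes [measurable]: "X \<in> borel_measurable M"
  shows "(\<integral>\<^sup>+\<omega>. ennreal (X \<omega>) \<partial>M) =
    (\<integral>\<^sup>+t. indicator {0..} t * emeasure M {\<omega> \<in> space M. t < X \<omega>} \<partial>lborel)"
proof -
  interpret P: pair_sigma_finite M lborel ..
  \<comment> \<open>For negative \<open>x\<close> the left side is truncated to 0 and the interval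
    on the right is empty.\<close>
  have "ennreal x = (\<integral>\<^sup>+t. indicator {0..<x} t \<partial>lborel)" for x :: real
    by (cases "0 \<le> x") (auto simp: ennreal_neg)
  then have "(\<integral>\<^sup>+\<omega>. ennreal (X \<omega>) \<partial>M) = (\<integral>\<^sup>+\<omega>. \<integral>\<^sup>+t. indicator {0..<X \<omega>} t \<partial>lborel \<partial>M)"
    by simp
  also have "\<dots> = (\<integral>\<^sup>+\<omega>. \<integral>\<^sup>+t. indicator {0..} t * indicator {t<..} (X \<omega>) \<partial>lborel \<partial>M)"
    by (intro nn_integral_cong) (auto split: split_indicator)
  also have "\<dots> = (\<integral>\<^sup>+t. \<integral>\<^sup>+\<omega>. indicator {0..} t * indicator {t<..} (X \<omega>) \<partial>M \<partial>lborel)"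
  \<comment> \<open>Joint measurability comes from the region below the graph of \<open>X\<close>, a
    measurable subset of the product space; there its indicator agrees with the one in the
    integrand.\<close>
  proof (rule P.Fubini'[symmetric])
    have "(\<lambda>(\<omega>, t). indicator {0..} t * indicator {z \<in> space (M \<Otimes>\<^sub>M lborel). snd z < X (fst z)} (\<omega>, t) :: ennreal)
        \<in> borel_measurable (M \<Otimes>\<^sub>M lborel)"
      by measurable
    then show "(\<lambda>(\<omega>, t). indicator {0..} t * indicator {t<..} (X \<omega>) :: ennreal)
        \<in> borel_measurable (M \<Otimes>\<^sub>M lborel)"
      by (rule measurable_cong[THEN iffD1, rotated])
         (auto simp: space_pair_measure split: split_indicator)
  qed
  also have "\<dots> = (\<integral>\<^sup>+t. indicator {0..} t * emeasure M {\<omega> \<in> space M. t < X \<omega>} \<partial>lborel)"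
  proof (rule nn_integral_cong)
    fix t :: real
    have "(\<integral>\<^sup>+\<omega>. indicator {0..} t * indicator {t<..} (X \<omega>) \<partial>M) =
        (\<integral>\<^sup>+\<omega>. indicator {0..} t * indicator {\<omega> \<in> space M. t < X \<omega>} \<omega> \<partial>M)"
      by (intro nn_integral_cong) (auto split: split_indicator)
    then show "(\<integral>\<^sup>+\<omega>. indicator {0..} t * indicator {t<..} (X \<omega>) \<partial>M) =
        indicator {0..} t * emeasure M {\<omega> \<in> space M. t < X \<omega>}"
      by (simp add: nn_integral_cmult)
  qed
  finally show ?thesis .
qed

text \<open>The factorials of the beta integral cancel against the binomial coefficient up to
  \<open>fact (i - 1) / fact i = 1 / i\<close>. The condition \<open>1 <= i\<close> makes the
  integrand decay.\<close>

lemma has_bochner_integral_tail_term: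
  fixes c a :: real
  assumes c: "c > 0" and i: "1 \<le> i" "i \<le> n"
  shows "has_bochner_integral lborel
    (\<lambda>t. real (n choose i) *
      (indicator {a..} t * ((1 - exp (- c * (t - a))) ^ (n - i) * exp (- c * (t - a)) ^ i)))
    (1 / (real i * c))"
proof -
  have "real (n choose i) * (fact (n - i) * fact (i - 1) / (fact n * c)) = 1 / (real i * c)"
  proof -
    have "fact i = real i * fact (i - 1)" using i by (simp add: fact_reduce)
    then show ?thesis using i c by (simp add: binomial_fact field_simps)
  qed
  moreover have "has_bochner_integral lborel
    (\<lambda>t. real (n choose i) *
      (indicator {a..} t * ((1 - exp (- c * (t - a))) ^ (n - i) * exp (- c * (t - a)) ^ i)))
    (real (n choose i) * (fact (n - i) * fact (i - 1) / (fact n * c)))"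
    using has_bochner_integral_beta_exp[OF c, of a "n - i" "i - 1"] i
    by (intro has_bochner_integral_mult_right) simp
  ultimately show ?thesis by simp
qed

lemma (in prob_space) expectation_eq_tail:
  assumes X [measurable]: "X \<in> borel_measurable M" and nonneg: "AE \<omega> in M. 0 \<le> X \<omega>"
    and int: "has_bochner_integral lborel (\<lambda>t. indicator {0..} t * prob {\<omega> \<in> space M. t < X \<omega>}) v"
  shows "expectation X = v"
proof -
  have "(\<integral>\<^sup>+\<omega>. ennreal (X \<omega>) \<partial>M) =
      (\<integral>\<^sup>+t. ennreal (indicator {0..} t * prob {\<omega> \<in> space M. t < X \<omega>}) \<partial>lborel)"
    unfolding nn_integral_eq_tail[OF X]
    by (intro nn_integral_cong) (auto simp: emeasure_eq_measure split: split_indicator)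
  also have "\<dots> = ennreal v"
    using int by (subst nn_integral_eq_integral) (auto simp: has_bochner_integral_iff)
  finally have "expectation X = enn2real (ennreal v)"
    using integral_eq_nn_integral[OF X nonneg] by simp
  \<comment> \<open>For negative \<open>v\<close> the value \<open>enn2real (ennreal v)\<close>
    would be 0 instead of \<open>v\<close>.\<close>
  moreover have "0 \<le> v"
    using int by (auto simp: has_bochner_integral_iff intro!: integral_nonneg_AE)
  ultimately show ?thesis by simp
qed

section \<open>The completion time\<close>

lemma sum_Pow_card:
  fixes h :: "nat \<Rightarrow> 'b::comm_semiring_1"
  assumes "finite A"
  shows "(\<Sum>S\<in>Pow A. h (card S)) = (\<Sum>m\<le>card A. of_nat (card A choose m) * h m)"
proof -
  have "(\<Sum>S\<in>Pow A. h (card S)) = (\<Sum>m\<le>card A. \<Sum>S | S \<in> Pow A \<and> card S = m. h (card S))"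
    using assms by (intro sum.group[symmetric]) (auto intro: card_mono)
  also have "\<dots> = (\<Sum>m\<le>card A. of_nat (card A choose m) * h m)"
  proof (rule sum.cong[OF refl])
    fix m
    have "(\<Sum>S | S \<in> Pow A \<and> card S = m. h (card S)) = of_nat (card {S. S \<subseteq> A \<and> card S = m}) * h m"
      by simp
    then show "(\<Sum>S | S \<in> Pow A \<and> card S = m. h (card S)) = of_nat (card A choose m) * h m"
      using n_subsets[OF assms] by simp
  qed
  finally show ?thesis .
qed

lemma (in prob_space) prob_indep_pair:
  assumes "indep_pair Ma X Mb Y" "A \<in> sets Ma" "B \<in> sets Mb"
  shows "prob ((X -` A \<inter> space M) \<inter> (Y -` B \<inter> space M)) =
    prob (X -` A \<inter> space M) * prob (Y -` B \<inter> space M)"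
  using assms unfolding indep_pair_def by (intro indep_setD) auto

lemma (in prob_space) prob_finished_set:
  assumes T: "indep_vars (\<lambda>_. borel) T {..<n}"
    and F: "\<And>i. i < n \<Longrightarrow> prob {\<omega> \<in> space M. T i \<omega> \<le> (t::real)} = F"
    and S: "S \<subseteq> {..<n}"
  shows "prob {\<omega> \<in> space M. {i. i < n \<and> T i \<omega> \<le> t} = S} = F ^ card S * (1 - F) ^ (n - card S)"
\<comment> \<open>For \<open>n = 0\<close> the intersection over the servers used below would be
  \<open>UNIV\<close> instead of \<open>space M\<close>.\<close>
proof (cases "n = 0")
  case True
  then show ?thesis using S by (simp add: prob_space)
next
  case False
  let ?A = "\<lambda>i. if i \<in> S then {..t} else {t<..}"
  have meas: "T i \<in> borel_measurable M" if "i < n" for i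
    using T that by (auto simp: indep_vars_def)
  have "{\<omega> \<in> space M. {i. i < n \<and> T i \<omega> \<le> t} = S} = (\<Inter>i\<in>{..<n}. T i -` ?A i \<inter> space M)"
  proof (rule Set.set_eqI)
    fix \<omega>
    have finished: "{i. i < n \<and> T i \<omega> \<le> t} = S \<longleftrightarrow> (\<forall>i<n. T i \<omega> \<le> t \<longleftrightarrow> i \<in> S)"
      using S by blast
    have mem: "x \<in> ?A i \<longleftrightarrow> (x \<le> t \<longleftrightarrow> i \<in> S)" for x i
      by (simp add: not_le)
    have "0 < n" using False by simp
    then show "\<omega> \<in> {\<omega> \<in> space M. {i. i < n \<and> T i \<omega> \<le> t} = S} \<longleftrightarrow>
        \<omega> \<in> (\<Inter>i\<in>{..<n}. T i -` ?A i \<inter> space M)"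
      unfolding INT_iff Int_iff vimage_eq mem_Collect_eq finished mem lessThan_iff by blast
  qed
  also have "prob \<dots> = (\<Prod>i\<in>{..<n}. prob (T i -` ?A i \<inter> space M))"
    using False by (intro indep_varsD_finite[OF T]) auto
  also have "\<dots> = (\<Prod>i\<in>{..<n}. if i \<in> S then F else 1 - F)"
  proof (rule prod.cong[OF refl])
    fix i assume "i \<in> {..<n}"
    then have i: "i < n" by simp
    note [measurable] = meas[OF i]
    have le: "T i -` {..t} \<inter> space M = {\<omega> \<in> space M. T i \<omega> \<le> t}" by auto
    have gt: "T i -` {t<..} \<inter> space M = space M - {\<omega> \<in> space M. T i \<omega> \<le> t}" by auto
    show "prob (T i -` ?A i \<inter> space M) = (if i \<in> S then F else 1 - F)"
      using F[OF i] by (auto simp: le gt prob_compl)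
  qed
  also have "\<dots> = F ^ card S * (1 - F) ^ (n - card S)"
  proof -
    have "{..<n} \<inter> S = S" "{..<n} \<inter> - S = {..<n} - S" using S by auto
    then show ?thesis
      using S by (simp add: prod.If_cases card_Diff_subset finite_subset[OF S])
  qed
  finally show ?thesis .
qed

text \<open>Decodability is monotone in time and, since \<open>k >= 1\<close> rules out decoding
  from no columns, sets in at one of the finitely many finishing times. The decoding times thus form
  a closed half-line \<open>{m..}\<close>, whose endpoint is the infimum.\<close>

lemma completion_time_le_iff:
  assumes A: "A \<in> generator_matrices n k" and k: "1 \<le> k"
  shows "completion_time n A \<tau> \<le> t \<longleftrightarrow> decodable A {i. i < n \<and> \<tau> i \<le> t}"
proof -
  let ?U = "\<lambda>t. {i. i < n \<and> \<tau> i \<le> t}"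
  let ?D = "{t. decodable A (?U t)}"
  let ?E = "?D \<inter> \<tau> ` {..<n}"
  have Ac: "A \<in> carrier_mat k n" and Adec: "decodable A {..<n}"
    using A by (simp_all add: generator_matrices_decodable)
  have up: "t' \<in> ?D" if "t \<in> ?D" "t \<le> t'" for t t'
  proof -
    have "?U t \<subseteq> ?U t'" "?U t' \<subseteq> {..<n}" using that by auto
    then show ?thesis using that decodable_mono[OF Ac] by blast
  qed
  \<comment> \<open>Decoding can only become possible when some server finishes, so the infimum is attained.\<close>
  have attained: "\<exists>e\<in>?E. e \<le> t" if t: "t \<in> ?D" for t
  proof -
    have ne: "?U t \<noteq> {}" using t not_decodable_empty[OF Ac k] by force
    \<comment> \<open>Between the last finishing time up to \<open>t\<close> and \<open>t\<close>
      itself the set of finished servers does not change.\<close>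
    let ?m = "Max (\<tau> ` ?U t)"
    have m: "?m \<in> \<tau> ` ?U t" using ne by (intro Max_in) auto
    have "\<tau> i \<le> ?m" if "i \<in> ?U t" for i using that by (intro Max_ge) auto
    then have "?U ?m = ?U t" using m by force
    then have "?m \<in> ?E" using t m by auto
    moreover have "?m \<le> t" using m by auto
    ultimately show ?thesis by blast
  qed
  \<comment> \<open>The sum of the absolute values bounds every run time, so by then all servers
    have finished and decoding is possible.\<close>
  have "?U (\<Sum>i<n. \<bar>\<tau> i\<bar>) = {..<n}"
    using member_le_sum[of _ "{..<n}" "\<lambda>i. \<bar>\<tau> i\<bar>"] abs_le_D1 by fastforce
  then have "(\<Sum>i<n. \<bar>\<tau> i\<bar>) \<in> ?D" using Adec by simp
  then have ne: "?E \<noteq> {}" using attained by blast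
  define m where "m = Min ?E"
  have m: "m \<in> ?E" unfolding m_def using ne by (intro Min_in) auto
  have "?D = {m..}"
  proof (intro equalityI subsetI)
    fix t assume "t \<in> ?D"
    then obtain e where e: "e \<in> ?E" "e \<le> t" using attained by blast
    have "m \<le> e" unfolding m_def using e(1) by (intro Min_le) auto
    then show "t \<in> {m..}" using e(2) by simp
  next
    fix t assume "t \<in> {m..}"
    then show "t \<in> ?D" using m up[of m t] by blast
  qed
  then have "completion_time n A \<tau> = m" and "t \<in> ?D \<longleftrightarrow> m \<le> t"
    by (simp_all only: completion_time_def cInf_atLeast atLeast_iff)
  then show ?thesis by (simp only: mem_Collect_eq)
qed

section \<open>Tail of the completion time for independent run times and an independent random
  code\<close>

context prob_space
begin

context
  fixes T :: "nat \<Rightarrow> 'a \<Rightarrow> real" and G :: "'a \<Rightarrow> bit mat" and n k :: nat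
  assumes k: "1 \<le> k" "k \<le> n"
    and T: "indep_vars (\<lambda>_. borel) T {..<n}"
    and law: "distr M (random_code_ensemble n k) G = random_code_ensemble n k"
    and indep: "indep_pair (Pi\<^sub>M {..<n} (\<lambda>_. borel)) (\<lambda>\<omega>. \<lambda>i\<in>{..<n}. T i \<omega>)
      (random_code_ensemble n k) G"
begin

lemma code_measurable: "G \<in> M \<rightarrow>\<^sub>M random_code_ensemble n k"
  using indep by (simp add: indep_pair_def)

lemma code_in_generator_matrices:
  assumes "\<omega> \<in> space M"
  shows "G \<omega> \<in> generator_matrices n k"
  using measurable_space[OF code_measurable assms]
  by (simp add: random_code_ensemble_def space_uniform_count_measure)

lemma prob_code:
  assumes B: "B \<subseteq> generator_matrices n k"
  shows "prob (G -` B \<inter> space M) = real (card B) / real (card (generator_matrices n k))"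
proof -
  have sets: "B \<in> sets (random_code_ensemble n k)"
    using B by (simp add: random_code_ensemble_def sets_uniform_count_measure)
  have "prob (G -` B \<inter> space M) = measure (distr M (random_code_ensemble n k) G) B"
    using measure_distr[OF code_measurable sets] by simp
  also have "\<dots> = measure (random_code_ensemble n k) B" by (simp only: law)
  also have "\<dots> = real (card B) / real (card (generator_matrices n k))"
    using measure_uniform_count_measure[OF finite_generator_matrices[OF k(2)] B]
    by (simp add: random_code_ensemble_def)
  finally show ?thesis .
qed

text \<open>The finished set takes finitely many values; where it equals \<open>S\<close>, the event
  concerns the code alone, and independence factors the probability. A general \<open>P\<close>
  serves \<open>decodable\<close>, for measurability, as well as its negation, for the tail.\<close>

lemma code_event:
  fixes P :: "bit mat \<Rightarrow> nat set \<Rightarrow> bool"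
  defines "U \<equiv> \<lambda>t \<omega>. {i. i < n \<and> T i \<omega> \<le> t}"
  shows code_event_measurable: "{\<omega> \<in> space M. P (G \<omega>) (U t \<omega>)} \<in> events"
    and prob_code_event: "prob {\<omega> \<in> space M. P (G \<omega>) (U t \<omega>)} =
      (\<Sum>S\<in>Pow {..<n}. prob {\<omega> \<in> space M. U t \<omega> = S} *
        (real (card {A \<in> generator_matrices n k. P A S}) / real (card (generator_matrices n k))))"
proof -
  let ?T = "\<lambda>\<omega>. \<lambda>i\<in>{..<n}. T i \<omega>"
  \<comment> \<open>The box of run-time vectors whose coordinates up to \<open>t\<close> are exactly
    those in \<open>S\<close>. It expresses the finished set as an event of the joint run-time
    vector, the form in which independence of the code is given.\<close>
  let ?C = "\<lambda>S. \<Pi>\<^sub>E i\<in>{..<n}. if i \<in> S then {..t} else {t<..}"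
  let ?B = "\<lambda>S. {A \<in> generator_matrices n k. P A S}"
  let ?E = "\<lambda>S. (?T -` ?C S \<inter> space M) \<inter> (G -` ?B S \<inter> space M)"
  have C: "?C S \<in> sets (Pi\<^sub>M {..<n} (\<lambda>_. borel))" for S
    by (intro sets_PiM_I_finite) auto
  have B: "?B S \<in> sets (random_code_ensemble n k)" for S
    by (auto simp: random_code_ensemble_def sets_uniform_count_measure)
  have U: "?T -` ?C S \<inter> space M = {\<omega> \<in> space M. U t \<omega> = S}" if "S \<in> Pow {..<n}" for S
  proof (rule Set.set_eqI)
    fix \<omega>
    have mem: "x \<in> (if i \<in> S then {..t} else {t<..}) \<longleftrightarrow> (x \<le> t \<longleftrightarrow> i \<in> S)" for x i
      by (simp add: not_le)
    have "?T \<omega> \<in> ?C S \<longleftrightarrow> (\<forall>i<n. T i \<omega> \<le> t \<longleftrightarrow> i \<in> S)"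
      by (simp add: PiE_iff mem Ball_def del: if_split)
    also have "\<dots> \<longleftrightarrow> U t \<omega> = S"
      using that by (auto simp: U_def)
    finally show "\<omega> \<in> ?T -` ?C S \<inter> space M \<longleftrightarrow> \<omega> \<in> {\<omega> \<in> space M. U t \<omega> = S}"
      by auto
  qed
  have "?T \<in> M \<rightarrow>\<^sub>M Pi\<^sub>M {..<n} (\<lambda>_. borel)"
    using indep by (simp add: indep_pair_def)
  then have E: "?E S \<in> events" for S
    using measurable_sets[OF _ C] measurable_sets[OF code_measurable B] by blast
  have eq: "{\<omega> \<in> space M. P (G \<omega>) (U t \<omega>)} = (\<Union>S\<in>Pow {..<n}. ?E S)"
  proof (rule Set.set_eqI)
    fix \<omega>
    have "U t \<omega> \<in> Pow {..<n}" by (auto simp: U_def)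
    then show "\<omega> \<in> {\<omega> \<in> space M. P (G \<omega>) (U t \<omega>)} \<longleftrightarrow> \<omega> \<in> (\<Union>S\<in>Pow {..<n}. ?E S)"
      using code_in_generator_matrices[of \<omega>] by (auto simp: U)
  qed
  show "{\<omega> \<in> space M. P (G \<omega>) (U t \<omega>)} \<in> events"
    unfolding eq using E by (intro sets.finite_UN) auto
  have disj: "disjoint_family_on ?E (Pow {..<n})"
    unfolding disjoint_family_on_def by (auto simp: U)
  have "prob {\<omega> \<in> space M. P (G \<omega>) (U t \<omega>)} = (\<Sum>S\<in>Pow {..<n}. prob (?E S))"
    unfolding eq using E disj by (intro finite_measure_finite_Union) auto
  also have "\<dots> = (\<Sum>S\<in>Pow {..<n}. prob {\<omega> \<in> space M. U t \<omega> = S} *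
        (real (card (?B S)) / real (card (generator_matrices n k))))"
  proof (rule sum.cong[OF refl])
    fix S assume S: "S \<in> Pow {..<n}"
    have "prob (?E S) = prob (?T -` ?C S \<inter> space M) * prob (G -` ?B S \<inter> space M)"
      by (rule prob_indep_pair[OF indep C B])
    also have "prob (G -` ?B S \<inter> space M) = real (card (?B S)) / real (card (generator_matrices n k))"
      by (intro prob_code) auto
    finally show "prob (?E S) = prob {\<omega> \<in> space M. U t \<omega> = S} *
        (real (card (?B S)) / real (card (generator_matrices n k)))"
      by (simp only: U[OF S])
  qed
  finally show "prob {\<omega> \<in> space M. P (G \<omega>) (U t \<omega>)} =
      (\<Sum>S\<in>Pow {..<n}. prob {\<omega> \<in> space M. U t \<omega> = S} *
        (real (card {A \<in> generator_matrices n k. P A S}) / real (card (generator_matrices n k))))" .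
qed

lemma completion_time_measurable:
  "(\<lambda>\<omega>. completion_time n (G \<omega>) (\<lambda>i. T i \<omega>)) \<in> borel_measurable M"
  unfolding borel_measurable_iff_le
proof
  fix t :: real
  have "{\<omega> \<in> space M. completion_time n (G \<omega>) (\<lambda>i. T i \<omega>) \<le> t} =
      {\<omega> \<in> space M. decodable (G \<omega>) {i. i < n \<and> T i \<omega> \<le> t}}"
    by (intro Collect_cong conj_cong refl)
      (rule completion_time_le_iff[OF code_in_generator_matrices k(1)])
  then show "{\<omega> \<in> space M. completion_time n (G \<omega>) (\<lambda>i. T i \<omega>) \<le> t} \<in> events"
    using code_event_measurable[of decodable t] by (simp only:)
qed

text \<open>The contribution of a finished set depends on its size only, so subsets are grouped by
  size; the final reindexing passes to the number \<open>i\<close> of unfinished servers.\<close>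

lemma prob_completion_time_gt:
  assumes F: "\<And>i. i < n \<Longrightarrow> prob {\<omega> \<in> space M. T i \<omega> \<le> t} = F"
  shows "prob {\<omega> \<in> space M. t < completion_time n (G \<omega>) (\<lambda>i. T i \<omega>)} =
    (\<Sum>i\<le>n. real (n choose i) * (F ^ (n - i) * (1 - F) ^ i * p_f n i k))"
proof -
  have "{\<omega> \<in> space M. t < completion_time n (G \<omega>) (\<lambda>i. T i \<omega>)} =
      {\<omega> \<in> space M. \<not> decodable (G \<omega>) {i. i < n \<and> T i \<omega> \<le> t}}"
    by (intro Collect_cong conj_cong refl)
      (simp only: completion_time_le_iff[OF code_in_generator_matrices k(1), symmetric] not_le)
  then have "prob {\<omega> \<in> space M. t < completion_time n (G \<omega>) (\<lambda>i. T i \<omega>)} =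
      (\<Sum>S\<in>Pow {..<n}. prob {\<omega> \<in> space M. {i. i < n \<and> T i \<omega> \<le> t} = S} *
        (real (card {A \<in> generator_matrices n k. \<not> decodable A S}) /
          real (card (generator_matrices n k))))"
    using prob_code_event[of "\<lambda>A S. \<not> decodable A S" t] by (simp only:)
  also have "\<dots> = (\<Sum>S\<in>Pow {..<n}. F ^ card S * (1 - F) ^ (n - card S) * p_f n (n - card S) k)"
    by (intro sum.cong refl) (simp add: prob_finished_set[OF T F] not_decodable_fraction[OF k(2)])
  also have "\<dots> = (\<Sum>m\<le>n. real (n choose m) * (F ^ m * (1 - F) ^ (n - m) * p_f n (n - m) k))"
    using sum_Pow_card[of "{..<n}" "\<lambda>m. F ^ m * (1 - F) ^ (n - m) * p_f n (n - m) k"] by simp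
  also have "\<dots> = (\<Sum>i\<le>n. real (n choose i) * (F ^ (n - i) * (1 - F) ^ i * p_f n i k))"
    by (rule sum.reindex_bij_witness[of _ "\<lambda>i. n - i" "\<lambda>i. n - i"])
      (auto simp: binomial_symmetric[symmetric])
  finally show ?thesis .
qed

end

end

section \<open>Integrating the tail to obtain the mean completion time\<close>

theorem corollary4:
  fixes M :: "'a measure"
    and T :: "nat \<Rightarrow> 'a \<Rightarrow> real"
    and G :: "'a \<Rightarrow> bit mat"
    and n k :: nat
    and \<mu> :: real
  assumes "prob_space M"
    and "1 \<le> k" and "k \<le> n" and "\<mu> > 0"
    and "prob_space.indep_vars M (\<lambda>_. borel) T {..<n}"
    and "\<And>i t. i < n \<Longrightarrow> measure M {\<omega> \<in> space M. T i \<omega> \<le> t} = run_time_cdf k \<mu> t"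
    and "distr M (random_code_ensemble n k) G = random_code_ensemble n k"
    and "prob_space.indep_pair M
           (Pi\<^sub>M {..<n} (\<lambda>_. borel)) (\<lambda>\<omega>. \<lambda>i\<in>{..<n}. T i \<omega>)
           (random_code_ensemble n k) G"
  shows "prob_space.expectation M (\<lambda>\<omega>. completion_time n (G \<omega>) (\<lambda>i. T i \<omega>)) =
    1 / real k * (1 + (\<Sum>i = n - k + 1..n. 1 / (real i * \<mu>))) +
    1 / (\<mu> * real k) * (\<Sum>i = 1..n - k. 1 / real i * p_f n i k)"
proof -
  interpret prob_space M by fact
  note k = assms(2,3) and \<mu> = assms(4) and code = assms(2,3,5,7,8)
  let ?X = "\<lambda>\<omega>. completion_time n (G \<omega>) (\<lambda>i. T i \<omega>)"
  let ?F = "run_time_cdf k \<mu>"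
  let ?c = "\<mu> * real k" and ?a = "1 / real k"
  have c: "?c > 0" using k \<mu> by simp
  have meas [measurable]: "?X \<in> borel_measurable M"
    by (rule completion_time_measurable[OF code])
  have tail: "prob {\<omega> \<in> space M. t < ?X \<omega>} =
      (\<Sum>i\<le>n. real (n choose i) * (?F t ^ (n - i) * (1 - ?F t) ^ i * p_f n i k))" for t
    by (rule prob_completion_time_gt[OF code]) (rule assms(6))
  \<comment> \<open>Before \<open>1 / k\<close> the distribution function is 0, so only
    \<open>i = n\<close> survives, where \<open>0 ^ 0 = 1\<close>; there \<open>p_f\<close> is 1
    because \<open>k >= 1\<close>.\<close>
  have tail_early: "prob {\<omega> \<in> space M. t < ?X \<omega>} = 1" if t: "t < ?a" for t
  proof -
    have "prob {\<omega> \<in> space M. t < ?X \<omega>} = (\<Sum>i\<le>n. if i = n then p_f n n k else 0)"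
      unfolding tail using t by (intro sum.cong) (auto simp: run_time_cdf_def)
    then show ?thesis using p_f_eq_1[of n k n] k by simp
  qed
  let ?h = "\<lambda>i t. real (n choose i) *
    (indicator {?a..} t * ((1 - exp (- ?c * (t - ?a))) ^ (n - i) * exp (- ?c * (t - ?a)) ^ i))"
  \<comment> \<open>The term \<open>i = 0\<close>, whose power product tends to 1 and is not
    integrable, drops out since \<open>p_f n 0 k = 0\<close>: a full-rank matrix decodes once all
    servers have finished.\<close>
  have tail_late: "prob {\<omega> \<in> space M. t < ?X \<omega>} = (\<Sum>i=1..n. p_f n i k * ?h i t)" if t: "?a \<le> t" for t
  proof -
    have expo: "- ?c * (t - ?a) = - \<mu> * (real k * t - 1)" using k by (simp add: field_simps)
    have F: "?F t = 1 - exp (- ?c * (t - ?a))"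
      unfolding expo using t by (simp add: run_time_cdf_def)
    have "prob {\<omega> \<in> space M. t < ?X \<omega>} = (\<Sum>i\<le>n. p_f n i k * ?h i t)"
      unfolding tail F using t by (intro sum.cong) (simp_all add: mult_ac)
    also have "{..n} = insert 0 {1..n}" by auto
    finally show ?thesis using p_f_0[OF k(2)] by simp
  qed
  have "has_bochner_integral lborel
      (\<lambda>t. indicator {0..<?a} t + (\<Sum>i=1..n. p_f n i k * ?h i t))
      (?a + (\<Sum>i=1..n. p_f n i k * (1 / (real i * ?c))))"
  proof (intro has_bochner_integral_add has_bochner_integral_sum has_bochner_integral_mult_right)
    show "has_bochner_integral lborel (indicator {0..<?a}) ?a"
      using has_bochner_integral_real_indicator[of "{0..<?a}" lborel] by simp
  qed (use has_bochner_integral_tail_term[OF c] in auto)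
  \<comment> \<open>Each \<open>?h i\<close> vanishes before \<open>1 / k\<close>, so the two
    summands describe the tail on disjoint intervals.\<close>
  moreover have "indicator {0..<?a} t + (\<Sum>i=1..n. p_f n i k * ?h i t) =
      indicator {0..} t * prob {\<omega> \<in> space M. t < ?X \<omega>}" for t
  proof (cases "t < ?a")
    case True
    then show ?thesis by (simp add: tail_early indicator_def)
  next
    case False
    moreover have "0 < ?a" using k by simp
    ultimately have "0 \<le> t" "t \<notin> {0..<?a}" by (linarith, simp)
    then show ?thesis using False tail_late[of t] by simp
  qed
  ultimately have int: "has_bochner_integral lborel
      (\<lambda>t. indicator {0..} t * prob {\<omega> \<in> space M. t < ?X \<omega>})
      (?a + (\<Sum>i=1..n. p_f n i k * (1 / (real i * ?c))))"
    by (simp only:)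
  \<comment> \<open>As \<open>0 < 1 / k\<close>, the early tail at time 0 says that the completion
    time is almost surely positive.\<close>
  have "AE \<omega> in M. 0 < ?X \<omega>"
    using tail_early[of 0] k by (subst prob_Collect_eq_1[symmetric]) auto
  then have "AE \<omega> in M. 0 \<le> ?X \<omega>" by eventually_elim simp
  from expectation_eq_tail[OF meas this int]
  have "expectation ?X = ?a + (\<Sum>i=1..n. p_f n i k * (1 / (real i * ?c)))" .
  \<comment> \<open>The sum is split at \<open>n - k\<close>: beyond it \<open>p_f\<close> is 1,
    which gives the sum inside the bracket of the claim.\<close>
  also have "(\<Sum>i=1..n. p_f n i k * (1 / (real i * ?c))) =
      (\<Sum>i=1..n - k. p_f n i k * (1 / (real i * ?c))) +
      (\<Sum>i=n - k + 1..n. p_f n i k * (1 / (real i * ?c)))"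
    using sum.ub_add_nat[of 1 "n - k" _ k] k by simp
  also have "(\<Sum>i=n - k + 1..n. p_f n i k * (1 / (real i * ?c))) =
      ?a * (\<Sum>i=n - k + 1..n. 1 / (real i * \<mu>))"
    unfolding sum_distrib_left using p_f_eq_1[of n k] by (intro sum.cong) (auto simp: mult_ac)
  also have "(\<Sum>i=1..n - k. p_f n i k * (1 / (real i * ?c))) =
      1 / ?c * (\<Sum>i=1..n - k. 1 / real i * p_f n i k)"
    unfolding sum_distrib_left by (intro sum.cong) (auto simp: mult_ac)
  finally show ?thesis by (simp add: distrib_left)
qed

end
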